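(* Let $U$ be the real scalar field and $z=z(\tau)$ the world-line of the point particle, with bare mass $\tilde m$ and scalar charge $a$, described in the context. Suppose $U$ is such that $$\forall x^0\ge 0,\qquad \lim_{\epsilon\to 0}\int_{z^1(x^0)-\epsilon}^{z^1(x^0)+\epsilon}T_S^{0\nu}(x^0,x^1)\,dx^1=0 \qquad(\nu=0,1).$$ (This requires that $T_S^{0\nu}$ be locally integrable around $z$.) Then, assuming energy-momentum conservation in the weak sense of $$\int_\Omega \partial_\mu T^{\mu 0}\,dV=0=\int_\Omega\partial_\mu T^{\mu 1}\,dV$$ for all tubular regions $\Omega$ around the particle's world-line, where $T^{\mu\nu}=T_p^{\mu\nu}+T_S^{\mu\nu}$, yields the unique force law $$\frac{dp^\nu}{d\tau}=-\Big[n_\mu T_S^{\mu\nu}(z^0,x^1)\Big]_{x^1=z^1},$$ where $n_\mu=(-u^1,u^0)$ is the space-like unit covector annihilated by the two-velocity $u^\mu$.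
   Context: Space-time is $\mathbb{R}^{1,1}$ with coordinates $(x^0,x^1)$ and metric $\eta_{\mu\nu}=\mathrm{diag}(1,-1)$; indices are raised and lowered with $\eta$ and repeated indices are summed. A point particle with bare mass $\tilde m$ and scalar charge $a$ is coupled to a massless real scalar field $U$. Its world-line $z(\tau)=(z^0(\tau),z^1(\tau))$ is time-like and parametrized by proper time $\tau$, with two-velocity $u^\mu=dz^\mu/d\tau$. Write $z^1(x^0)$ for the value of $z^1$ at the unique proper time at which $z^0=x^0$. The dynamical mass is $m(x^0)=\tilde m-aU(x^0,z^1(x^0))$ and the dynamical momentum is $p^\mu=m\,u^\mu$. The energy(-momentum-stress) tensors of the particle and of the field are $$T_p^{\mu\nu}(x)=m(x^0)\int u^\mu u^\nu\,\delta^{(2)}(x-z(\tau))\,d\tau,\qquad T_S^{\mu\nu}=(\partial^\mu U)(\partial^\nu U)-\tfrac12\eta^{\mu\nu}(\partial_\alpha U)(\partial^\alpha U).$$ A tubular region around the world-line is a set $\Omega=\{(x^0,x^1): T_1<x^0<T_2,\ |x^1-z^1(x^0)|<\epsilon\}$ with $\epsilon>0$. Because the total tensor $T^{\mu\nu}$ is singular on the world-line, derivatives are taken in the weak sense of distributions, so that $\int_\Omega\partial_\mu T^{\mu\nu}\,dV=\int_{\partial\Omega}T^{\alpha\nu}N_\alpha\,dS$, where $dS$ is the line element on $\partial\Omega$ induced by $\eta$ and $N_\alpha$ is the unit normal covector: $N=(1,0)$ on the side $x^0=T_2$, $N=(-1,0)$ on the side $x^0=T_1$, $N=n$ on the side $x^1=z^1(x^0)+\epsilon$,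 and $N=-n$ on the side $x^1=z^1(x^0)-\epsilon$. The bracket $[g(x^1)]_{x^1=z^1}$ denotes the jump in space of $g$ at $z^1$, i.e. $\lim_{\epsilon\to0^+}\big(g(z^1+\epsilon)-g(z^1-\epsilon)\big)$.
   Formalization: Added: the world-line is C^1 and complete; the jump exists for all x^0>=0, with the flux differences locally dominated by an integrable function along the world-line; the law is asserted at each proper time where the jump is continuous (it can fail at a shock). *)

theory Defs
  imports "HOL-Analysis.Analysis"
begin

text \<open>
  Space-time indices are the natural numbers 0 and 1; sums over repeated indices run over
  \<open>{..<2}\<close>.  A scalar field is a function \<open>U x0 x1\<close>, a curve is a function \<open>c \<mu> s\<close>, and a tensor
  field with two upper indices is a function \<open>S \<mu> \<nu> x0 x1\<close>.
\<close>

definition eta :: "nat \<Rightarrow> nat \<Rightarrow> real" where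
  "eta \<mu> \<nu> = (if \<mu> = \<nu> then (if \<mu> = 0 then 1 else - 1) else 0)"

definition partial_lower :: "(real \<Rightarrow> real \<Rightarrow> real) \<Rightarrow> nat \<Rightarrow> real \<Rightarrow> real \<Rightarrow> real" where
  "partial_lower U \<mu> x0 x1 =
     (if \<mu> = 0 then deriv (\<lambda>t. U t x1) x0 else deriv (\<lambda>y. U x0 y) x1)"

text \<open>The inverse of \<open>eta\<close> has the same entries as \<open>eta\<close>, so \<open>eta\<close> also raises indices.\<close>

definition partial_upper :: "(real \<Rightarrow> real \<Rightarrow> real) \<Rightarrow> nat \<Rightarrow> real \<Rightarrow> real \<Rightarrow> real" where
  "partial_upper U \<mu> x0 x1 = (\<Sum>\<alpha><2. eta \<mu> \<alpha> * partial_lower U \<alpha> x0 x1)"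

definition field_tensor :: "(real \<Rightarrow> real \<Rightarrow> real) \<Rightarrow> nat \<Rightarrow> nat \<Rightarrow> real \<Rightarrow> real \<Rightarrow> real" where
  "field_tensor U \<mu> \<nu> x0 x1 =
     partial_upper U \<mu> x0 x1 * partial_upper U \<nu> x0 x1
     - 1 / 2 * eta \<mu> \<nu> * (\<Sum>\<alpha><2. partial_lower U \<alpha> x0 x1 * partial_upper U \<alpha> x0 x1)"

definition velocity :: "(nat \<Rightarrow> real \<Rightarrow> real) \<Rightarrow> nat \<Rightarrow> real \<Rightarrow> real" where
  "velocity z \<mu> \<tau> = deriv (z \<mu>) \<tau>"

text \<open>
  A complete, future-directed, continuously differentiable time-like curve parametrized by proper
  time.  Since the velocity component 0 is at least 1, \<open>z 0\<close> is a bijection of the reals.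
\<close>

definition world_line :: "(nat \<Rightarrow> real \<Rightarrow> real) \<Rightarrow> bool" where
  "world_line z \<longleftrightarrow>
     (\<forall>\<mu><2. (\<forall>\<tau>. z \<mu> field_differentiable (at \<tau>)) \<and> continuous_on UNIV (velocity z \<mu>)) \<and>
     (\<forall>\<tau>. velocity z 0 \<tau> > 0) \<and>
     (\<forall>\<tau>. (\<Sum>\<mu><2. \<Sum>\<nu><2. eta \<mu> \<nu> * velocity z \<mu> \<tau> * velocity z \<nu> \<tau>) = 1)"

definition proper_time :: "(nat \<Rightarrow> real \<Rightarrow> real) \<Rightarrow> real \<Rightarrow> real" where
  "proper_time z x0 = (THE \<tau>. z 0 \<tau> = x0)"

definition position :: "(nat \<Rightarrow> real \<Rightarrow> real) \<Rightarrow> real \<Rightarrow> real" where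
  "position z x0 = z 1 (proper_time z x0)"

definition dyn_mass ::
  "real \<Rightarrow> real \<Rightarrow> (real \<Rightarrow> real \<Rightarrow> real) \<Rightarrow> (nat \<Rightarrow> real \<Rightarrow> real) \<Rightarrow> real \<Rightarrow> real" where
  "dyn_mass mt a U z x0 = mt - a * U x0 (position z x0)"

definition dyn_momentum ::
  "real \<Rightarrow> real \<Rightarrow> (real \<Rightarrow> real \<Rightarrow> real) \<Rightarrow> (nat \<Rightarrow> real \<Rightarrow> real) \<Rightarrow> nat \<Rightarrow> real \<Rightarrow> real" where
  "dyn_momentum mt a U z \<mu> \<tau> = dyn_mass mt a U z (z 0 \<tau>) * velocity z \<mu> \<tau>"

text \<open>
  The two-dimensional delta function is represented by the nascent delta functions
  \<open>\<lambda>x0 x1. box_delta h x0 * box_delta h x1\<close> in the limit \<open>h \<rightarrow> 0\<close> from the right.  Thus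
  \<open>particle_tensor\<close> is a family of ordinary tensor fields, indexed by \<open>h\<close>, that converges to the
  energy tensor of the particle; integrals of the latter are the limits of the integrals of the
  former.
\<close>

definition box_delta :: "real \<Rightarrow> real \<Rightarrow> real" where
  "box_delta h s = indicator {- h..h} s / (2 * h)"

definition particle_tensor ::
  "real \<Rightarrow> real \<Rightarrow> (real \<Rightarrow> real \<Rightarrow> real) \<Rightarrow> (nat \<Rightarrow> real \<Rightarrow> real) \<Rightarrow> real \<Rightarrow>
     nat \<Rightarrow> nat \<Rightarrow> real \<Rightarrow> real \<Rightarrow> real" where
  "particle_tensor mt a U z h \<mu> \<nu> x0 x1 =
     dyn_mass mt a U z x0 *
     (LBINT \<tau>. velocity z \<mu> \<tau> * velocity z \<nu> \<tau> *
               (box_delta h (x0 - z 0 \<tau>) * box_delta h (x1 - z 1 \<tau>)))"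

definition total_tensor ::
  "real \<Rightarrow> real \<Rightarrow> (real \<Rightarrow> real \<Rightarrow> real) \<Rightarrow> (nat \<Rightarrow> real \<Rightarrow> real) \<Rightarrow> real \<Rightarrow>
     nat \<Rightarrow> nat \<Rightarrow> real \<Rightarrow> real \<Rightarrow> real" where
  "total_tensor mt a U z h \<mu> \<nu> x0 x1 =
     particle_tensor mt a U z h \<mu> \<nu> x0 x1 + field_tensor U \<mu> \<nu> x0 x1"

definition unit_normal :: "(nat \<Rightarrow> real \<Rightarrow> real) \<Rightarrow> nat \<Rightarrow> real \<Rightarrow> real" where
  "unit_normal z \<mu> \<tau> = (if \<mu> = 0 then - velocity z 1 \<tau> else velocity z 0 \<tau>)"

text \<open>
  The integrand of the line integral of \<open>S \<alpha> \<nu> * N \<alpha>\<close> along the curve \<open>c\<close>: the square root is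
  the density of the line element induced by the metric.
\<close>

definition flux_density ::
  "(nat \<Rightarrow> real \<Rightarrow> real) \<Rightarrow> (nat \<Rightarrow> real \<Rightarrow> real) \<Rightarrow> (nat \<Rightarrow> nat \<Rightarrow> real \<Rightarrow> real \<Rightarrow> real) \<Rightarrow>
     nat \<Rightarrow> real \<Rightarrow> real" where
  "flux_density c N S \<nu> s =
     (\<Sum>\<alpha><2. S \<alpha> \<nu> (c 0 s) (c 1 s) * N \<alpha> s) *
     sqrt \<bar>\<Sum>\<mu><2. \<Sum>\<kappa><2. eta \<mu> \<kappa> * deriv (c \<mu>) s * deriv (c \<kappa>) s\<bar>"

text \<open>
  The four sides of the tubular region
  \<open>{(x0, x1). T1 < x0 \<and> x0 < T2 \<and> \<bar>x1 - position z x0\<bar> < \<epsilon>}\<close>, in the order \<open>x0 = T2\<close>,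
  \<open>x0 = T1\<close>, \<open>x1 = position z x0 + \<epsilon>\<close>, \<open>x1 = position z x0 - \<epsilon>\<close>.  Each side is given by a
  parametrization, the unit normal covector along it, and the two ends of the parameter interval;
  the last two sides are parametrized by the proper time of the world-line.
\<close>

definition tube_sides ::
  "(nat \<Rightarrow> real \<Rightarrow> real) \<Rightarrow> real \<Rightarrow> real \<Rightarrow> real \<Rightarrow>
     ((nat \<Rightarrow> real \<Rightarrow> real) \<times> (nat \<Rightarrow> real \<Rightarrow> real) \<times> real \<times> real) list" where
  "tube_sides z T1 T2 \<epsilon> =
     [(\<lambda>\<mu> s. if \<mu> = 0 then T2 else s, \<lambda>\<alpha> s. if \<alpha> = 0 then 1 else 0,
         position z T2 - \<epsilon>, position z T2 + \<epsilon>),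
      (\<lambda>\<mu> s. if \<mu> = 0 then T1 else s, \<lambda>\<alpha> s. if \<alpha> = 0 then - 1 else 0,
         position z T1 - \<epsilon>, position z T1 + \<epsilon>),
      (\<lambda>\<mu> \<tau>. if \<mu> = 0 then z 0 \<tau> else z 1 \<tau> + \<epsilon>, \<lambda>\<alpha> \<tau>. unit_normal z \<alpha> \<tau>,
         proper_time z T1, proper_time z T2),
      (\<lambda>\<mu> \<tau>. if \<mu> = 0 then z 0 \<tau> else z 1 \<tau> - \<epsilon>, \<lambda>\<alpha> \<tau>. - unit_normal z \<alpha> \<tau>,
         proper_time z T1, proper_time z T2)]"

definition boundary_integral ::
  "(nat \<Rightarrow> real \<Rightarrow> real) \<Rightarrow> (nat \<Rightarrow> nat \<Rightarrow> real \<Rightarrow> real \<Rightarrow> real) \<Rightarrow> nat \<Rightarrow>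
     real \<Rightarrow> real \<Rightarrow> real \<Rightarrow> real" where
  "boundary_integral z S \<nu> T1 T2 \<epsilon> =
     (\<Sum>(c, N, l, r) \<leftarrow> tube_sides z T1 T2 \<epsilon>. LBINT s:{l..r}. flux_density c N S \<nu> s)"

text \<open>
  The vanishing of the weak integral over a tubular region of the divergence of the total energy
  tensor.  By the divergence theorem this integral stands for the boundary integral, in which the
  field part has to be integrable on every side and the particle part is the limit of its
  regularizations.
\<close>

definition weakly_conserved ::
  "real \<Rightarrow> real \<Rightarrow> (real \<Rightarrow> real \<Rightarrow> real) \<Rightarrow> (nat \<Rightarrow> real \<Rightarrow> real) \<Rightarrow> nat \<Rightarrow>
     real \<Rightarrow> real \<Rightarrow> real \<Rightarrow> bool" where
  "weakly_conserved mt a U z \<nu> T1 T2 \<epsilon> \<longleftrightarrow>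
     (\<forall>(c, N, l, r) \<in> set (tube_sides z T1 T2 \<epsilon>).
        set_integrable lborel {l..r} (flux_density c N (field_tensor U) \<nu>)) \<and>
     ((\<lambda>h. boundary_integral z (total_tensor mt a U z h) \<nu> T1 T2 \<epsilon>) \<longlongrightarrow> 0) (at_right 0)"

definition space_diff :: "(real \<Rightarrow> real) \<Rightarrow> real \<Rightarrow> real \<Rightarrow> real" where
  "space_diff g y \<epsilon> = g (y + \<epsilon>) - g (y - \<epsilon>)"

text \<open>The bracket of \<open>g\<close> at \<open>y\<close>; meaningful only if the limit exists.\<close>

definition jump :: "(real \<Rightarrow> real) \<Rightarrow> real \<Rightarrow> real" where
  "jump g y = Lim (at_right 0) (space_diff g y)"

definition normal_flux ::
  "(real \<Rightarrow> real \<Rightarrow> real) \<Rightarrow> (nat \<Rightarrow> real \<Rightarrow> real) \<Rightarrow> nat \<Rightarrow> real \<Rightarrow> real \<Rightarrow> real" where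
  "normal_flux U z \<nu> \<tau> x1 = (\<Sum>\<mu><2. unit_normal z \<mu> \<tau> * field_tensor U \<mu> \<nu> (z 0 \<tau>) x1)"

text \<open>
  The regularity under which the jump along the world-line makes sense and is compatible with
  integration along the world-line: it exists at each time \<open>x0 \<ge> 0\<close>, and on compact pieces of the
  world-line the differences that converge to it have a common integrable bound.
\<close>

definition regular_jump ::
  "(real \<Rightarrow> real \<Rightarrow> real) \<Rightarrow> (nat \<Rightarrow> real \<Rightarrow> real) \<Rightarrow> nat \<Rightarrow> bool" where
  "regular_jump U z \<nu> \<longleftrightarrow>
     (\<forall>\<tau>. z 0 \<tau> \<ge> 0 \<longrightarrow>
        (\<exists>l. (space_diff (normal_flux U z \<nu> \<tau>) (z 1 \<tau>) \<longlongrightarrow> l) (at_right 0))) \<and>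
     (\<forall>\<tau>1 \<tau>2. 0 \<le> z 0 \<tau>1 \<longrightarrow> \<tau>1 < \<tau>2 \<longrightarrow>
        (\<exists>w \<delta>. \<delta> > 0 \<and> set_integrable lborel {\<tau>1..\<tau>2} w \<and>
           (\<forall>\<epsilon>\<in>{0<..<\<delta>}. AE \<tau> in lborel. \<tau> \<in> {\<tau>1..\<tau>2} \<longrightarrow>
              \<bar>space_diff (normal_flux U z \<nu> \<tau>) (z 1 \<tau>) \<epsilon>\<bar> \<le> w \<tau>)))"

end

theory Submission
  imports Defs
begin

text \<open>
  The sides \<open>x1 = position z x0 \<plusminus> \<epsilon>\<close> of a tube avoid the world-line, so the regularized particle
  tensor vanishes on them once \<open>2 * h < \<epsilon>\<close>; through the slice \<open>x0 = T\<close> its flux tends to the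
  momentum at time \<open>T\<close>.  Conservation on a tube of half-width \<open>\<epsilon>\<close> is therefore a balance between
  the momenta at the two ends, the field integrals over the two slices, and the proper-time integral
  of \<open>space_diff\<close> of the normal flux.  As \<open>\<epsilon> \<rightarrow> 0\<close> the slices drop out and dominated convergence
  gives \<open>p(\<tau>2) - p(\<tau>1) = - \<integral> jump\<close>, which is differentiated where the jump is continuous.
\<close>

section \<open>Box functions and the line element on a slice\<close>

lemma sum_lessThan_two: "(\<Sum>i<2. f i) = f 0 + f (1::nat)" for f :: "nat \<Rightarrow> real"
  by (simp add: numeral_2_eq_2)

lemma integral_box_delta:
  assumes "0 < h" "a \<le> x - h" "x + h \<le> b"
  shows "(LBINT s. indicator {a..b} s * box_delta h (s - x)) = 1"
proof -
  have "(LBINT s. indicator {a..b} s * box_delta h (s - x)) =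
      (LBINT s. indicator {x - h..x + h} s / (2 * h))"
    using assms by (intro Bochner_Integration.integral_cong) (auto simp: box_delta_def indicator_def)
  also have "\<dots> = 1"
    using assms by simp
  finally show ?thesis .
qed

lemma borel_measurable_box_delta [measurable]: "box_delta h \<in> borel_measurable borel"
  unfolding box_delta_def by measurable

text \<open>A slice is parametrized by x1 itself, so its tangent is (0, 1) and the induced line
  element has density \<open>sqrt \<bar>- 1\<bar> = 1\<close>. The factor \<open>c\<close> is the
  sign of the outward normal, which lets both slices be treated at once.\<close>

lemma flux_density_slice:
  "flux_density (\<lambda>\<mu> s. if \<mu> = 0 then T else s) (\<lambda>\<alpha> s. if \<alpha> = 0 then c else 0) S \<nu> =
    (\<lambda>s. c * S 0 \<nu> T s)"
proof -
  \<comment> \<open>At a fixed index the parametrization is a constant or the identity; in this form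
    its derivative is immediate.\<close>
  have if_fun: "If True T = (\<lambda>s. T)" "If False T = (\<lambda>s. s)"
    by auto
  show ?thesis
    by (rule ext) (simp add: if_fun flux_density_def sum_lessThan_two eta_def)
qed

section \<open>World-lines\<close>

context
  fixes z :: "nat \<Rightarrow> real \<Rightarrow> real"
  assumes wl: "world_line z"
begin

lemma DERIV_world_line:
  assumes "\<mu> < 2"
  shows "(z \<mu> has_real_derivative velocity z \<mu> \<tau>) (at \<tau>)"
  using wl assms unfolding world_line_def velocity_def
  by (simp add: DERIV_deriv_iff_field_differentiable)

lemma continuous_velocity: "\<mu> < 2 \<Longrightarrow> continuous_on A (velocity z \<mu>)"
  using wl unfolding world_line_def by (meson continuous_on_subset top_greatest)

lemma velocity_mass_shell: "(velocity z 0 \<tau>)\<^sup>2 - (velocity z 1 \<tau>)\<^sup>2 = 1"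
  using wl unfolding world_line_def
  by (simp add: sum_lessThan_two eta_def power2_eq_square)

lemma velocity_0_pos: "0 < velocity z 0 \<tau>"
  using wl unfolding world_line_def by blast

lemma velocity_0_ge_1: "1 \<le> velocity z 0 \<tau>"
proof (rule power2_le_imp_le)
  have "1 + (velocity z 1 \<tau>)\<^sup>2 = (velocity z 0 \<tau>)\<^sup>2"
    using velocity_mass_shell[of \<tau>] by simp
  then show "1\<^sup>2 \<le> (velocity z 0 \<tau>)\<^sup>2"
    by (metis le_add_same_cancel1 one_power2 zero_le_power2)
qed (rule less_imp_le[OF velocity_0_pos])

lemma abs_velocity_1_le: "\<bar>velocity z 1 \<tau>\<bar> \<le> velocity z 0 \<tau>"
proof (rule power2_le_imp_le)
  have "1 + (velocity z 1 \<tau>)\<^sup>2 = (velocity z 0 \<tau>)\<^sup>2"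
    using velocity_mass_shell[of \<tau>] by simp
  then show "\<bar>velocity z 1 \<tau>\<bar>\<^sup>2 \<le> (velocity z 0 \<tau>)\<^sup>2"
    by (metis le_add_same_cancel2 power2_abs zero_le_one)
qed (rule less_imp_le[OF velocity_0_pos])

text \<open>By the mass shell relation \<open>velocity z 0\<close> is at least 1, so
  \<open>z 0 s - s\<close> is nondecreasing. This quantitative growth makes \<open>z 0\<close>
  surjective and its inverse 1-Lipschitz.\<close>

lemma time_expanding:
  assumes "\<tau> \<le> \<sigma>"
  shows "\<sigma> - \<tau> \<le> z 0 \<sigma> - z 0 \<tau>"
proof -
  have "z 0 \<tau> - \<tau> \<le> z 0 \<sigma> - \<sigma>"
    using assms
  proof (rule DERIV_nonneg_imp_nondecreasing)
    show "\<exists>y. ((\<lambda>s. z 0 s - s) has_real_derivative y) (at x) \<and> 0 \<le> y" for x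
      using velocity_0_ge_1[of x]
      by (intro exI[of _ "velocity z 0 x - 1"]) (auto intro!: derivative_eq_intros DERIV_world_line)
  qed
  then show ?thesis by simp
qed

lemma strict_mono_time: "strict_mono (z 0)"
proof (rule strict_monoI)
  show "z 0 \<tau> < z 0 \<sigma>" if "\<tau> < \<sigma>" for \<tau> \<sigma>
    using time_expanding[of \<tau> \<sigma>] that by linarith
qed

lemma continuous_world_line: "\<mu> < 2 \<Longrightarrow> continuous_on A (z \<mu>)"
  by (intro continuous_at_imp_continuous_on ballI) (rule DERIV_isCont[OF DERIV_world_line])

lemma time_proper_time: "z 0 (proper_time z x) = x"
  unfolding proper_time_def
proof (rule theI')
  \<comment> \<open>Since \<open>z 0\<close> grows at least at unit rate, moving from proper time 0
    by the distance between \<open>x\<close> and \<open>z 0 0\<close> reaches or passes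
    \<open>x\<close>.\<close>
  let ?d = "\<bar>x - z 0 0\<bar>"
  have "z 0 (- ?d) \<le> x"
    using time_expanding[of "- ?d" 0] by linarith
  moreover have "x \<le> z 0 ?d"
    using time_expanding[of 0 ?d] by linarith
  moreover have "continuous_on {- ?d..?d} (z 0)"
    by (rule continuous_world_line) simp
  moreover have "- ?d \<le> ?d"
    by simp
  ultimately have "\<exists>\<tau>\<ge>- ?d. \<tau> \<le> ?d \<and> z 0 \<tau> = x"
    by (intro IVT')
  then obtain \<tau> where \<tau>: "z 0 \<tau> = x"
    by (elim exE conjE)
  show "\<exists>!\<tau>. z 0 \<tau> = x"
  proof (rule ex1I)
    fix \<sigma> assume "z 0 \<sigma> = x"
    then have "z 0 \<sigma> = z 0 \<tau>"
      by (simp only: \<tau>)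
    then show "\<sigma> = \<tau>"
      by (rule strict_mono_eq[OF strict_mono_time, THEN iffD1])
  qed (rule \<tau>)
qed

lemma proper_time_time: "proper_time z (z 0 \<tau>) = \<tau>"
  using strict_mono_eq[OF strict_mono_time, of "proper_time z (z 0 \<tau>)" \<tau>]
  by (simp add: time_proper_time)

lemma time_le_iff: "z 0 \<sigma> \<le> x \<longleftrightarrow> \<sigma> \<le> proper_time z x"
  using strict_mono_less_eq[OF strict_mono_time, of \<sigma> "proper_time z x"]
  by (simp only: time_proper_time)

lemma le_time_iff: "x \<le> z 0 \<sigma> \<longleftrightarrow> proper_time z x \<le> \<sigma>"
  using strict_mono_less_eq[OF strict_mono_time, of "proper_time z x" \<sigma>]
  by (simp only: time_proper_time)

text \<open>The null coordinates \<open>z 0 + z 1\<close> and \<open>z 0 - z 1\<close> are both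
  nondecreasing, because the spatial velocity is dominated by the temporal one. This is what
  confines the smeared particle near its position whenever the time difference is small.\<close>

lemma world_line_causal: "\<bar>z 1 \<sigma> - z 1 \<tau>\<bar> \<le> \<bar>z 0 \<sigma> - z 0 \<tau>\<bar>"
proof -
  have *: "\<bar>z 1 \<sigma> - z 1 \<tau>\<bar> \<le> z 0 \<sigma> - z 0 \<tau>" if "\<tau> \<le> \<sigma>" for \<sigma> \<tau>
  proof -
    have "z 0 \<tau> + c * z 1 \<tau> \<le> z 0 \<sigma> + c * z 1 \<sigma>" if c: "c = 1 \<or> c = - 1" for c
      using \<open>\<tau> \<le> \<sigma>\<close>
    proof (rule DERIV_nonneg_imp_nondecreasing)
      show "\<exists>y. ((\<lambda>s. z 0 s + c * z 1 s) has_real_derivative y) (at x) \<and> 0 \<le> y" for x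
        using abs_velocity_1_le[of x] c
        by (intro exI[of _ "velocity z 0 x + c * velocity z 1 x"])
          (auto intro!: derivative_eq_intros DERIV_world_line)
    qed
    from this[of 1] this[of "-1"] show ?thesis by simp
  qed
  show ?thesis
    using *[of \<tau> \<sigma>] *[of \<sigma> \<tau>] by (cases "\<tau> \<le> \<sigma>") (auto simp: abs_minus_commute)
qed

lemma isCont_proper_time: "isCont (proper_time z) x"
proof -
  have "\<bar>proper_time z y - proper_time z x\<bar> \<le> \<bar>y - x\<bar>" for y
    using time_expanding[of "proper_time z x" "proper_time z y"]
      time_expanding[of "proper_time z y" "proper_time z x"]
    by (cases "proper_time z x \<le> proper_time z y") (auto simp: time_proper_time)
  then show ?thesis
    unfolding isCont_def LIM_def dist_real_def by (blast intro: le_less_trans)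
qed

text \<open>The derivative of the inverse function is the time dilation factor, which reappears as
  the Jacobian of the delta function in time.\<close>

lemma DERIV_proper_time:
  "(proper_time z has_real_derivative inverse (velocity z 0 (proper_time z x))) (at x)"
  using velocity_0_pos[of "proper_time z x"]
  by (intro DERIV_inverse_function[where a = "x - 1" and b = "x + 1" and f = "z 0"]
      DERIV_world_line isCont_proper_time time_proper_time) auto

section \<open>The flux of the particle tensor\<close>

text \<open>If both box factors were nonzero at some \<sigma>, the time difference would be at most
  \<open>h\<close>, hence by causality also the difference of positions, and the second box would
  force \<open>\<bar>d\<bar> \<le> 2 * h\<close>.\<close>

lemma particle_tensor_off_line:
  assumes "0 < h" "2 * h < \<bar>d\<bar>"
  shows "particle_tensor mt a U z h \<mu> \<nu> (z 0 \<tau>) (z 1 \<tau> + d) = 0"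
proof -
  have "box_delta h (z 0 \<tau> - z 0 \<sigma>) * box_delta h (z 1 \<tau> + d - z 1 \<sigma>) = 0" for \<sigma>
    using world_line_causal[of \<tau> \<sigma>] assms
    by (auto simp: box_delta_def indicator_def)
  then show ?thesis
    by (simp only: particle_tensor_def mult_zero_right Bochner_Integration.integral_zero)
qed

text \<open>The composition rule for a delta function with \<open>z 0\<close>, with Jacobian
  \<open>1 / velocity z 0\<close>. The box average of \<open>f\<close> is a symmetric difference
  quotient at \<open>T\<close> of an antiderivative of \<open>f\<close> composed with
  \<open>proper_time z\<close>.\<close>

lemma integral_time_delta:
  assumes f: "continuous_on UNIV f"
  shows "((\<lambda>h. LBINT \<sigma>. f \<sigma> * box_delta h (T - z 0 \<sigma>)) \<longlongrightarrow>
           f (proper_time z T) / velocity z 0 (proper_time z T)) (at_right 0)"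
proof -
  let ?P = "proper_time z"
  have "\<And>x. isCont f x"
    using f by (simp add: continuous_on_eq_continuous_at)
  then obtain G where G: "\<And>x. (G has_real_derivative f x) (at x)"
    using einterval_antiderivative[of "-\<infinity>" "\<infinity>" f]
    by (auto simp: has_real_derivative_iff_has_vector_derivative)
  define K where "K = (\<lambda>x. G (?P x))"
  let ?D = "f (?P T) / velocity z 0 (?P T)"
  have K: "(K has_real_derivative ?D) (at T)"
    unfolding K_def divide_inverse by (rule DERIV_chain2[OF G DERIV_proper_time])
  \<comment> \<open>The symmetric quotient is written as the mean of the forward and the backward
    quotient, each of which tends to the derivative of \<open>K\<close>.\<close>
  have "(LBINT \<sigma>. f \<sigma> * box_delta h (T - z 0 \<sigma>)) =
      ((K (T + h) - K T) / h + (K (T + - h) - K T) / (- h)) / 2" if "0 < h" for h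
  proof -
    have "(LBINT \<sigma>. f \<sigma> * box_delta h (T - z 0 \<sigma>)) =
        (LBINT \<sigma>. f \<sigma> * indicator {?P (T - h)..?P (T + h)} \<sigma> / (2 * h))"
      by (intro Bochner_Integration.integral_cong)
        (auto simp: box_delta_def indicator_def time_le_iff[symmetric] le_time_iff[symmetric])
    also have "\<dots> = (LBINT \<sigma>. f \<sigma> * indicator {?P (T - h)..?P (T + h)} \<sigma>) / (2 * h)"
      by simp
    also have "(LBINT \<sigma>. f \<sigma> * indicator {?P (T - h)..?P (T + h)} \<sigma>) = K (T + h) - K (T - h)"
      unfolding K_def
    proof (rule integral_FTC_Icc_real)
      show "?P (T - h) \<le> ?P (T + h)"
        using that by (simp add: le_time_iff[symmetric] time_proper_time)
    qed (use G \<open>\<And>x. isCont f x\<close> in auto)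
    finally show ?thesis
      using that by (simp add: field_simps)
  qed
  moreover have "((\<lambda>h. ((K (T + h) - K T) / h + (K (T + - h) - K T) / (- h)) / 2) \<longlongrightarrow> (?D + ?D) / 2)
      (at_right 0)"
  proof -
    have q: "((\<lambda>h. (K (T + h) - K T) / h) \<longlongrightarrow> ?D) (at 0)"
      using K by (simp add: DERIV_def)
    have "filterlim uminus (at 0) (at_right (0::real))"
      by (intro filterlim_atI tendsto_eq_intros)
        (auto simp: eventually_at_filter tendsto_ident_at intro!: tendsto_eq_intros)
    then have minus: "((\<lambda>h. (K (T + - h) - K T) / (- h)) \<longlongrightarrow> ?D) (at_right 0)"
      by (rule filterlim_compose[OF q])
    have plus: "((\<lambda>h. (K (T + h) - K T) / h) \<longlongrightarrow> ?D) (at_right 0)"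
      using q by (rule filterlim_mono) (auto intro: at_le)
    show ?thesis
      by (rule tendsto_divide[OF tendsto_add[OF plus minus] tendsto_const]) simp
  qed
  ultimately show ?thesis
    by (auto simp: eventually_at_right_less elim!: Lim_transform_eventually eventually_mono
        intro: eventually_at_rightI[of 0 1])
qed

lemma borel_measurable_world_line [measurable]: "\<mu> < 2 \<Longrightarrow> z \<mu> \<in> borel_measurable borel"
  by (rule borel_measurable_continuous_onI) (rule continuous_world_line)

text \<open>Prepares the exchange of integrals: the integrand is bounded and vanishes off a compact
  rectangle, on which \<open>f\<close> is bounded by compactness and each box by
  \<open>1 / (2 * h)\<close>.\<close>

lemma slice_delta_integrable:
  assumes f: "continuous_on UNIV f" and "0 < h"
  shows "integrable (lborel \<Otimes>\<^sub>M lborel)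
    (\<lambda>(s, \<sigma>). indicator {a..b} s * (f \<sigma> * (box_delta h (T - z 0 \<sigma>) * box_delta h (s - z 1 \<sigma>))))"
proof -
  \<comment> \<open>The proper times at which the time factor is nonzero, that is, the preimage of
    \<open>{T - h..T + h}\<close> under \<open>z 0\<close>.\<close>
  let ?I = "{proper_time z (T - h)..proper_time z (T + h)}"
  have [measurable]: "f \<in> borel_measurable borel"
    using f by (rule borel_measurable_continuous_onI)
  have "bounded (f ` ?I)"
    by (intro compact_imp_bounded compact_continuous_image continuous_on_subset[OF f]) auto
  then obtain B where B: "\<And>\<sigma>. \<sigma> \<in> ?I \<Longrightarrow> \<bar>f \<sigma>\<bar> \<le> B"
    unfolding bounded_iff real_norm_def by blast
  have box: "box_delta h x \<le> 1 / (2 * h)" "0 \<le> box_delta h x" for x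
    using \<open>0 < h\<close> by (auto simp: box_delta_def indicator_def)
  show ?thesis
  proof (rule integrableI_bounded_set[where A = "{a..b} \<times> ?I" and B = "B * (1 / (2 * h) * (1 / (2 * h)))"])
    show "emeasure (lborel \<Otimes>\<^sub>M lborel) ({a..b} \<times> ?I) < \<infinity>"
      by (simp add: lborel.emeasure_pair_measure_Times emeasure_lborel_Icc_eq ennreal_mult_less_top)
    show "AE x in lborel \<Otimes>\<^sub>M lborel. x \<in> {a..b} \<times> ?I \<longrightarrow>
      norm (case x of (s, \<sigma>) \<Rightarrow> indicator {a..b} s *
        (f \<sigma> * (box_delta h (T - z 0 \<sigma>) * box_delta h (s - z 1 \<sigma>)))) \<le> B * (1 / (2 * h) * (1 / (2 * h)))"
    proof (intro AE_I2 impI)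
      fix x assume "x \<in> {a..b} \<times> ?I"
      then obtain s \<sigma> where x: "x = (s, \<sigma>)" "s \<in> {a..b}" "\<sigma> \<in> ?I" by blast
      have "\<bar>f \<sigma>\<bar> * (box_delta h (T - z 0 \<sigma>) * box_delta h (s - z 1 \<sigma>)) \<le> B * (1 / (2 * h) * (1 / (2 * h)))"
        using B[OF x(3)] box \<open>0 < h\<close> by (intro mult_mono mult_nonneg_nonneg) (auto intro: order_trans[OF abs_ge_zero])
      then show "norm (case x of (s, \<sigma>) \<Rightarrow> indicator {a..b} s *
        (f \<sigma> * (box_delta h (T - z 0 \<sigma>) * box_delta h (s - z 1 \<sigma>)))) \<le> B * (1 / (2 * h) * (1 / (2 * h)))"
        using x box by (simp add: abs_mult)
    qed
    show "AE x in lborel \<Otimes>\<^sub>M lborel. x \<notin> {a..b} \<times> ?I \<longrightarrow>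
      (case x of (s, \<sigma>) \<Rightarrow> indicator {a..b} s *
        (f \<sigma> * (box_delta h (T - z 0 \<sigma>) * box_delta h (s - z 1 \<sigma>)))) = 0"
      by (intro AE_I2)
        (auto simp: box_delta_def indicator_def time_le_iff[symmetric] le_time_iff[symmetric])
    show "{a..b} \<times> ?I \<in> sets (lborel \<Otimes>\<^sub>M lborel)"
      by simp
    show "(\<lambda>(s, \<sigma>). indicator {a..b} s * (f \<sigma> * (box_delta h (T - z 0 \<sigma>) * box_delta h (s - z 1 \<sigma>))))
      \<in> borel_measurable (lborel \<Otimes>\<^sub>M lborel)"
      by measurable
  qed
qed

lemma slice_integrable:
  assumes "continuous_on UNIV f" "0 < h"
  shows "set_integrable lborel {a..b}
    (\<lambda>s. LBINT \<sigma>. f \<sigma> * (box_delta h (T - z 0 \<sigma>) * box_delta h (s - z 1 \<sigma>)))"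
  using lborel_pair.integrable_fst'[OF slice_delta_integrable[OF assms, of a b T]]
  by (simp add: set_integrable_def)

text \<open>Integrating over the slice first, the spatial box contributes its full mass 1 wherever
  the time box is nonzero, because it then lies entirely inside the slice.\<close>

lemma slice_integral:
  assumes f: "continuous_on UNIV f" and h: "0 < h" "2 * h < \<epsilon>"
  shows "(LBINT s:{position z T - \<epsilon>..position z T + \<epsilon>}.
      LBINT \<sigma>. f \<sigma> * (box_delta h (T - z 0 \<sigma>) * box_delta h (s - z 1 \<sigma>))) =
    (LBINT \<sigma>. f \<sigma> * box_delta h (T - z 0 \<sigma>))"
proof -
  let ?S = "{position z T - \<epsilon>..position z T + \<epsilon>}"
  have "(LBINT s:?S. LBINT \<sigma>. f \<sigma> * (box_delta h (T - z 0 \<sigma>) * box_delta h (s - z 1 \<sigma>))) =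
      (LBINT s. LBINT \<sigma>. indicator ?S s * (f \<sigma> * (box_delta h (T - z 0 \<sigma>) * box_delta h (s - z 1 \<sigma>))))"
    by (simp add: set_lebesgue_integral_def)
  also have "\<dots> = (LBINT \<sigma>. LBINT s. indicator ?S s *
      (f \<sigma> * (box_delta h (T - z 0 \<sigma>) * box_delta h (s - z 1 \<sigma>))))"
    by (rule lborel_pair.Fubini_integral[OF slice_delta_integrable[OF f h(1)], symmetric])
  also have "\<dots> = (LBINT \<sigma>. f \<sigma> * box_delta h (T - z 0 \<sigma>) *
      (LBINT s. indicator ?S s * box_delta h (s - z 1 \<sigma>)))"
    by (simp add: mult.left_commute mult.assoc flip: Bochner_Integration.integral_mult_right_zero)
  also have "\<dots> = (LBINT \<sigma>. f \<sigma> * box_delta h (T - z 0 \<sigma>))"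
  proof (intro Bochner_Integration.integral_cong refl)
    fix \<sigma>
    show "f \<sigma> * box_delta h (T - z 0 \<sigma>) * (LBINT s. indicator ?S s * box_delta h (s - z 1 \<sigma>)) =
        f \<sigma> * box_delta h (T - z 0 \<sigma>)"
    proof (cases "\<bar>T - z 0 \<sigma>\<bar> \<le> h")
      case True
      \<comment> \<open>Causality bounds the offset of the box's centre by \<open>h\<close>; its
        half-width adds another \<open>h\<close>, and \<open>2 * h < \<epsilon>\<close> keeps it
        inside. In the other case the time factor is zero and both sides vanish.\<close>
      then have "\<bar>position z T - z 1 \<sigma>\<bar> \<le> h"
        using world_line_causal[of "proper_time z T" \<sigma>] by (simp add: position_def time_proper_time)
      then have "position z T - \<epsilon> \<le> z 1 \<sigma> - h" "z 1 \<sigma> + h \<le> position z T + \<epsilon>"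
        using h by (auto simp: abs_le_iff)
      then show ?thesis
        by (simp add: integral_box_delta[OF h(1)])
    qed (auto simp: box_delta_def indicator_def)
  qed
  finally show ?thesis .
qed

section \<open>The balance law\<close>

text \<open>A spatial translate of the world-line has the same tangent \<open>u\<close>, so by the
  mass shell relation proper time is also arc length on the lateral sides and the density is
  1.\<close>

lemma flux_density_lateral:
  assumes "(w has_real_derivative velocity z 1 \<tau>) (at \<tau>)"
  shows "flux_density (\<lambda>\<mu> \<tau>. if \<mu> = 0 then z 0 \<tau> else w \<tau>) N S \<nu> \<tau> =
    (\<Sum>\<alpha><2. N \<alpha> \<tau> * S \<alpha> \<nu> (z 0 \<tau>) (w \<tau>))"
  using DERIV_imp_deriv[OF assms] velocity_mass_shell[of \<tau>]
  by (simp add: flux_density_def sum_lessThan_two eta_def power2_eq_square velocity_def[symmetric]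
      mult.commute)

lemma flux_density_lateral_sides:
  "flux_density (\<lambda>\<mu> \<tau>. if \<mu> = 0 then z 0 \<tau> else z 1 \<tau> + \<epsilon>) (\<lambda>\<alpha> \<tau>. unit_normal z \<alpha> \<tau>) S \<nu> =
    (\<lambda>\<tau>. \<Sum>\<alpha><2. unit_normal z \<alpha> \<tau> * S \<alpha> \<nu> (z 0 \<tau>) (z 1 \<tau> + \<epsilon>))"
  "flux_density (\<lambda>\<mu> \<tau>. if \<mu> = 0 then z 0 \<tau> else z 1 \<tau> - \<epsilon>) (\<lambda>\<alpha> \<tau>. - unit_normal z \<alpha> \<tau>) S \<nu> =
    (\<lambda>\<tau>. - (\<Sum>\<alpha><2. unit_normal z \<alpha> \<tau> * S \<alpha> \<nu> (z 0 \<tau>) (z 1 \<tau> - \<epsilon>)))"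
proof -
  have "((\<lambda>\<tau>. z 1 \<tau> + \<epsilon>) has_real_derivative velocity z 1 \<tau>) (at \<tau>)"
    "((\<lambda>\<tau>. z 1 \<tau> - \<epsilon>) has_real_derivative velocity z 1 \<tau>) (at \<tau>)" for \<tau>
    by (auto intro!: derivative_eq_intros DERIV_world_line)
  note d = this[THEN flux_density_lateral]
  show "flux_density (\<lambda>\<mu> \<tau>. if \<mu> = 0 then z 0 \<tau> else z 1 \<tau> + \<epsilon>) (\<lambda>\<alpha> \<tau>. unit_normal z \<alpha> \<tau>) S \<nu> =
      (\<lambda>\<tau>. \<Sum>\<alpha><2. unit_normal z \<alpha> \<tau> * S \<alpha> \<nu> (z 0 \<tau>) (z 1 \<tau> + \<epsilon>))"
    by (rule ext) (rule d(1))
  show "flux_density (\<lambda>\<mu> \<tau>. if \<mu> = 0 then z 0 \<tau> else z 1 \<tau> - \<epsilon>) (\<lambda>\<alpha> \<tau>. - unit_normal z \<alpha> \<tau>) S \<nu> =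
      (\<lambda>\<tau>. - (\<Sum>\<alpha><2. unit_normal z \<alpha> \<tau> * S \<alpha> \<nu> (z 0 \<tau>) (z 1 \<tau> - \<epsilon>)))"
    unfolding d(2) by (simp add: fun_eq_iff sum_negf)
qed

lemma boundary_integral_eq:
  "boundary_integral z S \<nu> T1 T2 \<epsilon> =
    (LBINT s:{position z T2 - \<epsilon>..position z T2 + \<epsilon>}. S 0 \<nu> T2 s)
    - (LBINT s:{position z T1 - \<epsilon>..position z T1 + \<epsilon>}. S 0 \<nu> T1 s)
    + (LBINT \<tau>:{proper_time z T1..proper_time z T2}.
        \<Sum>\<alpha><2. unit_normal z \<alpha> \<tau> * S \<alpha> \<nu> (z 0 \<tau>) (z 1 \<tau> + \<epsilon>))
    - (LBINT \<tau>:{proper_time z T1..proper_time z T2}.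
        \<Sum>\<alpha><2. unit_normal z \<alpha> \<tau> * S \<alpha> \<nu> (z 0 \<tau>) (z 1 \<tau> - \<epsilon>))"
  unfolding boundary_integral_def tube_sides_def
  by (simp only: list.map sum_list.Cons sum_list.Nil prod.case flux_density_slice
      flux_density_lateral_sides) (simp add: set_lebesgue_integral_def)

text \<open>The particle part smears \<open>velocity z 0 * velocity z \<nu>\<close>; the Jacobian of
  the time delta cancels the factor \<open>velocity z 0\<close>, and the mass times
  \<open>velocity z \<nu>\<close> remains, which is the momentum. The field part does not depend on
  \<open>h\<close>.\<close>

lemma slice_flux_tendsto:
  assumes \<nu>: "\<nu> < 2" and \<epsilon>: "0 < \<epsilon>"
    and S: "set_integrable lborel {position z (z 0 \<tau>) - \<epsilon>..position z (z 0 \<tau>) + \<epsilon>} (field_tensor U 0 \<nu> (z 0 \<tau>))"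
  shows "((\<lambda>h. LBINT s:{position z (z 0 \<tau>) - \<epsilon>..position z (z 0 \<tau>) + \<epsilon>}. total_tensor mt a U z h 0 \<nu> (z 0 \<tau>) s)
    \<longlongrightarrow> dyn_momentum mt a U z \<nu> \<tau> +
      (LBINT s:{position z (z 0 \<tau>) - \<epsilon>..position z (z 0 \<tau>) + \<epsilon>}. field_tensor U 0 \<nu> (z 0 \<tau>) s)) (at_right 0)"
proof -
  let ?T = "z 0 \<tau>"
  let ?I = "{position z ?T - \<epsilon>..position z ?T + \<epsilon>}"
  let ?f = "\<lambda>\<sigma>. velocity z 0 \<sigma> * velocity z \<nu> \<sigma>"
  let ?m = "dyn_mass mt a U z ?T"
  let ?F = "LBINT s:?I. field_tensor U 0 \<nu> ?T s"
  have f: "continuous_on UNIV ?f"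
    using \<nu> by (intro continuous_intros continuous_velocity) auto
  have lim: "((\<lambda>h. ?m * (LBINT \<sigma>. ?f \<sigma> * box_delta h (?T - z 0 \<sigma>)) + ?F) \<longlongrightarrow>
      ?m * (?f \<tau> / velocity z 0 \<tau>) + ?F) (at_right 0)"
    using integral_time_delta[OF f, of ?T] unfolding proper_time_time by (intro tendsto_intros)
  have eq: "(LBINT s:?I. total_tensor mt a U z h 0 \<nu> ?T s) =
      ?m * (LBINT \<sigma>. ?f \<sigma> * box_delta h (?T - z 0 \<sigma>)) + ?F" if h: "0 < h" "2 * h < \<epsilon>" for h
    unfolding total_tensor_def particle_tensor_def
    using slice_integrable[OF f h(1), of "position z ?T - \<epsilon>" "position z ?T + \<epsilon>" ?T] S
    by (subst set_integral_add(2)) (auto simp: slice_integral[OF f h] simp del: One_nat_def)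
  have "\<forall>\<^sub>F h in at_right 0. 0 < h \<and> 2 * h < \<epsilon>"
    using \<epsilon> by (intro eventually_at_rightI[of 0 "\<epsilon> / 2"]) auto
  then have "\<forall>\<^sub>F h in at_right 0. ?m * (LBINT \<sigma>. ?f \<sigma> * box_delta h (?T - z 0 \<sigma>)) + ?F =
      (LBINT s:?I. total_tensor mt a U z h 0 \<nu> ?T s)"
    by eventually_elim (simp add: eq)
  from Lim_transform_eventually[OF lim this] velocity_0_pos[of \<tau>]
  show ?thesis
    by (simp add: dyn_momentum_def)
qed

text \<open>For \<open>2 * h < \<epsilon>\<close> only the field crosses the lateral sides, and
  their opposite normals combine the two fluxes into \<open>space_diff\<close>. The regularization
  is removed here at fixed \<epsilon>, before the tube shrinks.\<close>

lemma conservation_balance: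
  assumes \<nu>: "\<nu> < 2" and \<epsilon>: "0 < \<epsilon>"
    and cons: "weakly_conserved mt a U z \<nu> (z 0 \<tau>1) (z 0 \<tau>2) \<epsilon>"
  shows "set_integrable lborel {\<tau>1..\<tau>2} (\<lambda>\<tau>. space_diff (normal_flux U z \<nu> \<tau>) (z 1 \<tau>) \<epsilon>)" (is ?int)
    and "dyn_momentum mt a U z \<nu> \<tau>2 - dyn_momentum mt a U z \<nu> \<tau>1 =
      (LBINT s:{position z (z 0 \<tau>1) - \<epsilon>..position z (z 0 \<tau>1) + \<epsilon>}. field_tensor U 0 \<nu> (z 0 \<tau>1) s)
      - (LBINT s:{position z (z 0 \<tau>2) - \<epsilon>..position z (z 0 \<tau>2) + \<epsilon>}. field_tensor U 0 \<nu> (z 0 \<tau>2) s)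
      - (LBINT \<tau>:{\<tau>1..\<tau>2}. space_diff (normal_flux U z \<nu> \<tau>) (z 1 \<tau>) \<epsilon>)" (is ?bal)
proof -
  let ?I = "\<lambda>\<tau>. {position z (z 0 \<tau>) - \<epsilon>..position z (z 0 \<tau>) + \<epsilon>}"
  let ?p = "dyn_momentum mt a U z \<nu>"
  let ?F = "\<lambda>\<tau>. LBINT s:?I \<tau>. field_tensor U 0 \<nu> (z 0 \<tau>) s"
  let ?R = "\<lambda>\<tau>. normal_flux U z \<nu> \<tau> (z 1 \<tau> + \<epsilon>)"
  let ?L = "\<lambda>\<tau>. normal_flux U z \<nu> \<tau> (z 1 \<tau> - \<epsilon>)"
  have int: "set_integrable lborel (?I \<tau>2) (field_tensor U 0 \<nu> (z 0 \<tau>2))"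
    "set_integrable lborel (?I \<tau>1) (\<lambda>s. - field_tensor U 0 \<nu> (z 0 \<tau>1) s)"
    "set_integrable lborel {\<tau>1..\<tau>2} ?R"
    "set_integrable lborel {\<tau>1..\<tau>2} (\<lambda>\<tau>. - ?L \<tau>)"
    using cons unfolding weakly_conserved_def tube_sides_def
    by (simp_all add: flux_density_slice flux_density_lateral_sides proper_time_time normal_flux_def
        cong: set_integrable_cong)
  \<comment> \<open>On the slice at \<open>z 0 \<tau>1\<close> and on the left side the outward
    normal carries a minus sign, which is removed from the integrability statements.\<close>
  have int1: "set_integrable lborel (?I \<tau>1) (field_tensor U 0 \<nu> (z 0 \<tau>1))"
    using set_integrable_mult_right[OF int(2), of "- 1"] by simp
  have intL: "set_integrable lborel {\<tau>1..\<tau>2} ?L"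
    using set_integrable_mult_right[OF int(4), of "- 1"] by simp
  show ?int
    unfolding space_diff_def using int(3) intL by (rule set_integral_diff)
  let ?A = "\<lambda>\<tau> h. LBINT s:?I \<tau>. total_tensor mt a U z h 0 \<nu> (z 0 \<tau>) s"
  let ?D = "(LBINT \<tau>:{\<tau>1..\<tau>2}. ?R \<tau>) - (LBINT \<tau>:{\<tau>1..\<tau>2}. ?L \<tau>)"
  have "boundary_integral z (total_tensor mt a U z h) \<nu> (z 0 \<tau>1) (z 0 \<tau>2) \<epsilon> = ?A \<tau>2 h - ?A \<tau>1 h + ?D"
    if h: "0 < h" "2 * h < \<epsilon>" for h
  proof -
    have "particle_tensor mt a U z h \<mu> \<nu> (z 0 \<tau>) (z 1 \<tau> + \<epsilon>) = 0"
      "particle_tensor mt a U z h \<mu> \<nu> (z 0 \<tau>) (z 1 \<tau> - \<epsilon>) = 0" for \<mu> \<tau>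
      using particle_tensor_off_line[of h \<epsilon>] particle_tensor_off_line[of h "- \<epsilon>"] h by auto
    then show ?thesis
      unfolding boundary_integral_eq proper_time_time
      by (simp add: total_tensor_def normal_flux_def set_lebesgue_integral_def)
  qed
  then have "\<forall>\<^sub>F h in at_right 0.
      boundary_integral z (total_tensor mt a U z h) \<nu> (z 0 \<tau>1) (z 0 \<tau>2) \<epsilon> = ?A \<tau>2 h - ?A \<tau>1 h + ?D"
    using \<epsilon> by (intro eventually_at_rightI[of 0 "\<epsilon> / 2"]) auto
  with cons have "((\<lambda>h. ?A \<tau>2 h - ?A \<tau>1 h + ?D) \<longlongrightarrow> 0) (at_right 0)"
    unfolding weakly_conserved_def by (blast intro: Lim_transform_eventually)
  moreover have "((\<lambda>h. ?A \<tau>2 h - ?A \<tau>1 h + ?D) \<longlongrightarrow> (?p \<tau>2 + ?F \<tau>2) - (?p \<tau>1 + ?F \<tau>1) + ?D) (at_right 0)"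
    by (intro tendsto_intros slice_flux_tendsto \<nu> \<epsilon> int(1) int1)
  \<comment> \<open>The boundary integral has limit 0 by conservation and the computed limit by its
    decomposition; the two must agree.\<close>
  ultimately have "(?p \<tau>2 + ?F \<tau>2) - (?p \<tau>1 + ?F \<tau>1) + ?D = 0"
    by (rule tendsto_unique[OF trivial_limit_at_right_real, symmetric])
  moreover have "?D = (LBINT \<tau>:{\<tau>1..\<tau>2}. space_diff (normal_flux U z \<nu> \<tau>) (z 1 \<tau>) \<epsilon>)"
    unfolding space_diff_def using int(3) intL by (rule set_integral_diff(2)[symmetric])
  ultimately show ?bal by linarith
qed

end

section \<open>The jump along the world-line\<close>

lemma tendsto_jump:
  assumes "regular_jump U z \<nu>" "0 \<le> z 0 \<tau>"
  shows "(space_diff (normal_flux U z \<nu> \<tau>) (z 1 \<tau>) \<longlongrightarrow> jump (normal_flux U z \<nu> \<tau>) (z 1 \<tau>)) (at_right 0)"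
proof -
  obtain l where l: "(space_diff (normal_flux U z \<nu> \<tau>) (z 1 \<tau>) \<longlongrightarrow> l) (at_right 0)"
    using assms unfolding regular_jump_def by blast
  then have "jump (normal_flux U z \<nu> \<tau>) (z 1 \<tau>) = l"
    unfolding jump_def by (intro tendsto_Lim) auto
  with l show ?thesis by simp
qed

text \<open>Dominated convergence with the bound from \<open>regular_jump\<close>. Since that
  theorem is used for sequences, the half-widths run through a null sequence, which may depend on
  the interval through the \<delta> of the bound. The jump is measurable as a pointwise
  limit.\<close>

lemma tendsto_integral_space_diff:
  assumes wl: "world_line z" and reg: "regular_jump U z \<nu>" and \<tau>: "0 \<le> z 0 \<tau>1" "\<tau>1 < \<tau>2"
    and int: "\<And>\<epsilon>. 0 < \<epsilon> \<Longrightarrow> set_integrable lborel {\<tau>1..\<tau>2} (\<lambda>\<tau>. space_diff (normal_flux U z \<nu> \<tau>) (z 1 \<tau>) \<epsilon>)"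
  shows "\<exists>X. (\<forall>n. 0 < X n) \<and> X \<longlonglongrightarrow> 0 \<and>
      set_integrable lborel {\<tau>1..\<tau>2} (\<lambda>\<tau>. jump (normal_flux U z \<nu> \<tau>) (z 1 \<tau>)) \<and>
      (\<lambda>n. LBINT \<tau>:{\<tau>1..\<tau>2}. space_diff (normal_flux U z \<nu> \<tau>) (z 1 \<tau>) (X n)) \<longlonglongrightarrow>
        (LBINT \<tau>:{\<tau>1..\<tau>2}. jump (normal_flux U z \<nu> \<tau>) (z 1 \<tau>))"
proof -
  let ?g = "\<lambda>\<epsilon> \<tau>. indicator {\<tau>1..\<tau>2} \<tau> *\<^sub>R space_diff (normal_flux U z \<nu> \<tau>) (z 1 \<tau>) \<epsilon>"
  let ?j = "\<lambda>\<tau>. indicator {\<tau>1..\<tau>2} \<tau> *\<^sub>R jump (normal_flux U z \<nu> \<tau>) (z 1 \<tau>)"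
  obtain w \<delta> where \<delta>: "0 < \<delta>" and w: "set_integrable lborel {\<tau>1..\<tau>2} w"
    and bound: "\<And>\<epsilon>. \<epsilon> \<in> {0<..<\<delta>} \<Longrightarrow> AE \<tau> in lborel. \<tau> \<in> {\<tau>1..\<tau>2} \<longrightarrow>
       \<bar>space_diff (normal_flux U z \<nu> \<tau>) (z 1 \<tau>) \<epsilon>\<bar> \<le> w \<tau>"
    using reg \<tau> unfolding regular_jump_def by meson
  \<comment> \<open>The shift by 2 keeps already the first term strictly below \<delta>, where the
    bound holds.\<close>
  define X where "X n = \<delta> / real (n + 2)" for n
  have X: "0 < X n" "X n < \<delta>" for n
    using \<delta> by (auto simp: X_def field_simps intro: add_pos_nonneg)
  have X0: "X \<longlonglongrightarrow> 0"
    unfolding X_def by (rule LIMSEQ_ignore_initial_segment[OF lim_const_over_n])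
  then have "filterlim X (at_right 0) sequentially"
    using X by (intro tendsto_imp_filterlim_at_right) auto
  then have lim: "(\<lambda>n. ?g (X n) \<tau>) \<longlonglongrightarrow> ?j \<tau>" for \<tau>
  proof (cases "\<tau> \<in> {\<tau>1..\<tau>2}")
    case True
    with \<tau> have "0 \<le> z 0 \<tau>"
      using strict_mono_less_eq[OF strict_mono_time[OF wl], of \<tau>1 \<tau>] by simp
    from filterlim_compose[OF tendsto_jump[OF reg this] \<open>filterlim X (at_right 0) sequentially\<close>]
    show ?thesis
      by (intro tendsto_intros)
  qed simp
  have meas: "?g (X n) \<in> borel_measurable lborel" for n
    using int[OF X(1)] unfolding set_integrable_def by (rule borel_measurable_integrable)
  have jmeas: "?j \<in> borel_measurable lborel"
    by (rule borel_measurable_LIMSEQ_real[OF lim meas])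
  have bnd: "AE \<tau> in lborel. norm (?g (X n) \<tau>) \<le> indicator {\<tau>1..\<tau>2} \<tau> *\<^sub>R w \<tau>" for n
    using bound[of "X n"] X by (auto simp: indicator_def)
  note dom = jmeas meas w[unfolded set_integrable_def] AE_I2[OF lim] bnd
  show ?thesis
    using X(1) X0 integrable_dominated_convergence[OF dom] integral_dominated_convergence[OF dom]
    unfolding set_integrable_def set_lebesgue_integral_def by blast
qed

section \<open>From the integrated force law to the pointwise one\<close>

text \<open>The momentum difference in the balance law does not depend on \<epsilon>. Along a null
  sequence of half-widths the slice integrals vanish, so this constant equals the limit of the
  remaining lateral term.\<close>

lemma momentum_diff:
  assumes wl: "world_line z" and \<nu>: "\<nu> < 2" and reg: "regular_jump U z \<nu>"
    and no_concentration: "\<And>x0. 0 \<le> x0 \<Longrightarrow>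
          ((\<lambda>\<epsilon>. LBINT x1:{position z x0 - \<epsilon>..position z x0 + \<epsilon>}. field_tensor U 0 \<nu> x0 x1)
             \<longlongrightarrow> 0) (at_right 0)"
    and conservation: "\<And>T1 T2 \<epsilon>. 0 \<le> T1 \<Longrightarrow> T1 < T2 \<Longrightarrow> 0 < \<epsilon> \<Longrightarrow>
          weakly_conserved mt a U z \<nu> T1 T2 \<epsilon>"
    and \<tau>: "0 \<le> z 0 \<tau>1" "\<tau>1 < \<tau>2"
  shows "set_integrable lborel {\<tau>1..\<tau>2} (\<lambda>\<tau>. jump (normal_flux U z \<nu> \<tau>) (z 1 \<tau>))"
    and "dyn_momentum mt a U z \<nu> \<tau>2 - dyn_momentum mt a U z \<nu> \<tau>1 =
      - (LBINT \<tau>:{\<tau>1..\<tau>2}. jump (normal_flux U z \<nu> \<tau>) (z 1 \<tau>))"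
proof -
  let ?F = "\<lambda>x0 \<epsilon>. LBINT x1:{position z x0 - \<epsilon>..position z x0 + \<epsilon>}. field_tensor U 0 \<nu> x0 x1"
  let ?p = "dyn_momentum mt a U z \<nu>"
  have lt: "z 0 \<tau>1 < z 0 \<tau>2"
    using strict_mono_time[OF wl] \<tau> by (simp add: strict_mono_less)
  note bal = conservation_balance[OF wl \<nu> _ conservation[OF \<tau>(1) lt]]
  obtain X where X: "\<And>n. 0 < X n" "X \<longlonglongrightarrow> 0"
    and int: "set_integrable lborel {\<tau>1..\<tau>2} (\<lambda>\<tau>. jump (normal_flux U z \<nu> \<tau>) (z 1 \<tau>))"
    and lim: "(\<lambda>n. LBINT \<tau>:{\<tau>1..\<tau>2}. space_diff (normal_flux U z \<nu> \<tau>) (z 1 \<tau>) (X n)) \<longlonglongrightarrow>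
        (LBINT \<tau>:{\<tau>1..\<tau>2}. jump (normal_flux U z \<nu> \<tau>) (z 1 \<tau>))"
    using tendsto_integral_space_diff[OF wl reg \<tau> bal(1)] by blast
  show "set_integrable lborel {\<tau>1..\<tau>2} (\<lambda>\<tau>. jump (normal_flux U z \<nu> \<tau>) (z 1 \<tau>))"
    by fact
  have "filterlim X (at_right 0) sequentially"
    using X by (intro tendsto_imp_filterlim_at_right) auto
  then have F: "(\<lambda>n. ?F x0 (X n)) \<longlonglongrightarrow> 0" if "0 \<le> x0" for x0
    using no_concentration[OF that] by (rule filterlim_compose[rotated])
  have "(\<lambda>n. ?F (z 0 \<tau>1) (X n) - ?F (z 0 \<tau>2) (X n)
      - (LBINT \<tau>:{\<tau>1..\<tau>2}. space_diff (normal_flux U z \<nu> \<tau>) (z 1 \<tau>) (X n))) \<longlonglongrightarrow>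
      0 - 0 - (LBINT \<tau>:{\<tau>1..\<tau>2}. jump (normal_flux U z \<nu> \<tau>) (z 1 \<tau>))"
    using \<tau>(1) lt by (intro tendsto_diff F lim) auto
  moreover have "?F (z 0 \<tau>1) (X n) - ?F (z 0 \<tau>2) (X n)
      - (LBINT \<tau>:{\<tau>1..\<tau>2}. space_diff (normal_flux U z \<nu> \<tau>) (z 1 \<tau>) (X n)) = ?p \<tau>2 - ?p \<tau>1" for n
    using bal(2)[of "X n"] X(1)[of n] by simp
  ultimately show "?p \<tau>2 - ?p \<tau>1 = - (LBINT \<tau>:{\<tau>1..\<tau>2}. jump (normal_flux U z \<nu> \<tau>) (z 1 \<tau>))"
    by (simp add: LIMSEQ_const_iff)
qed

text \<open>The fundamental theorem of calculus with continuity of \<open>g\<close> assumed at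
  \<tau> only. \<open>S\<close> is closed upwards, so a segment between two of its points stays in
  \<open>S\<close>; at a least element of \<open>S\<close> the derivative is one-sided.\<close>

lemma has_real_derivative_of_integral:
  fixes p g :: "real \<Rightarrow> real"
  assumes int: "\<And>x y. x \<in> S \<Longrightarrow> x < y \<Longrightarrow> set_integrable lborel {x..y} g"
    and p: "\<And>x y. x \<in> S \<Longrightarrow> x < y \<Longrightarrow> p y - p x = (LBINT s:{x..y}. g s)"
    and S: "\<And>x y. x \<in> S \<Longrightarrow> x \<le> y \<Longrightarrow> y \<in> S"
    and \<tau>: "\<tau> \<in> S" and cont: "continuous (at \<tau> within S) g"
  shows "(p has_real_derivative g \<tau>) (at \<tau> within S)"
proof -
  have mean: "\<bar>(p y - p x) - g \<tau> * (y - x)\<bar> \<le> e * (y - x)"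
    if "x \<in> S" "x < y" and e: "\<And>s. s \<in> {x..y} \<Longrightarrow> \<bar>g s - g \<tau>\<bar> \<le> e" for x y e
  proof -
    have c: "set_integrable lborel {x..y} (\<lambda>s. c)" "(LBINT s:{x..y}. c) = c * (y - x)" for c :: real
      using \<open>x < y\<close> by (auto simp: set_integrable_def set_lebesgue_integral_def)
    \<comment> \<open>On the segment \<open>g\<close> is squeezed between the constants
      \<open>g \<tau> - e\<close> and \<open>g \<tau> + e\<close>, and integration preserves both
      inequalities.\<close>
    have "(LBINT s:{x..y}. g s) \<le> (LBINT s:{x..y}. g \<tau> + e)"
      using e by (intro set_integral_mono int c that) (force simp: abs_le_iff)
    moreover have "(LBINT s:{x..y}. g \<tau> - e) \<le> (LBINT s:{x..y}. g s)"
      using e by (intro set_integral_mono int c that) (force simp: abs_le_iff)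
    ultimately show ?thesis
      unfolding c p[OF that(1,2)] by (simp add: abs_le_iff algebra_simps)
  qed
  show ?thesis
    unfolding has_field_derivative_def has_derivative_within_alt
  proof (intro conjI allI impI)
    show "bounded_linear ((*) (g \<tau>))"
      by (rule bounded_linear_mult_right)
    fix e :: real assume "0 < e"
    then obtain d where d: "0 < d" "\<And>s. s \<in> S \<Longrightarrow> \<bar>s - \<tau>\<bar> < d \<Longrightarrow> \<bar>g s - g \<tau>\<bar> < e"
      using cont unfolding continuous_within_eps_delta dist_real_def by blast
    show "\<exists>d>0. \<forall>y\<in>S. norm (y - \<tau>) < d \<longrightarrow> norm (p y - p \<tau> - g \<tau> * (y - \<tau>)) \<le> e * norm (y - \<tau>)"
    proof (intro exI conjI ballI impI)
      fix y assume y: "y \<in> S" "norm (y - \<tau>) < d"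
      \<comment> \<open>Such an \<open>s\<close> lies above \<open>min y \<tau>\<close>, which is in
        \<open>S\<close>, and is no farther from \<tau> than \<open>y\<close> is.\<close>
      have near: "\<bar>g s - g \<tau>\<bar> \<le> e" if "min y \<tau> \<le> s" "s \<le> max y \<tau>" for s
        using that y \<tau> S[of "min y \<tau>" s] d(2)[of s] by (auto simp: min_def max_def split: if_splits)
      consider "y = \<tau>" | "\<tau> < y" | "y < \<tau>" by linarith
      then show "norm (p y - p \<tau> - g \<tau> * (y - \<tau>)) \<le> e * norm (y - \<tau>)"
      proof cases
        case 2
        then show ?thesis
          using mean[of \<tau> y e] \<tau> near by simp
      next
        case 3
        then show ?thesis
          using mean[of y \<tau> e] y near by (simp add: abs_le_iff algebra_simps)
      qed simp
    qed (fact d(1))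
  qed
qed

text \<open>The equivalence expresses existence and uniqueness of the force together. Derivatives
  are taken within the times \<open>z 0 \<sigma> \<ge> 0\<close>, so at time 0 the law is
  one-sided.\<close>

theorem theorem2p1:
  fixes U :: "real \<Rightarrow> real \<Rightarrow> real"
    and z :: "nat \<Rightarrow> real \<Rightarrow> real"
    and mt a \<tau> F :: real
    and \<nu> :: nat
  assumes world_line: "world_line z"
    and locally_integrable: "\<And>x0 \<nu>. 0 \<le> x0 \<Longrightarrow> \<nu> < 2 \<Longrightarrow>
          \<exists>\<delta>>0. set_integrable lborel {position z x0 - \<delta>..position z x0 + \<delta>}
                  (field_tensor U 0 \<nu> x0)"
    and no_concentration: "\<And>x0 \<nu>. 0 \<le> x0 \<Longrightarrow> \<nu> < 2 \<Longrightarrow>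
          ((\<lambda>\<epsilon>. LBINT x1:{position z x0 - \<epsilon>..position z x0 + \<epsilon>}. field_tensor U 0 \<nu> x0 x1)
             \<longlongrightarrow> 0) (at_right 0)"
    and conservation: "\<And>T1 T2 \<epsilon> \<nu>. 0 \<le> T1 \<Longrightarrow> T1 < T2 \<Longrightarrow> 0 < \<epsilon> \<Longrightarrow> \<nu> < 2 \<Longrightarrow>
          weakly_conserved mt a U z \<nu> T1 T2 \<epsilon>"
    and regular: "\<And>\<nu>. \<nu> < 2 \<Longrightarrow> regular_jump U z \<nu>"
    and \<nu>: "\<nu> < 2"
    and \<tau>: "0 \<le> z 0 \<tau>"
    and continuous_jump: "continuous (at \<tau> within {\<sigma>. 0 \<le> z 0 \<sigma>})
          (\<lambda>\<sigma>. jump (normal_flux U z \<nu> \<sigma>) (z 1 \<sigma>))"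
  shows "(dyn_momentum mt a U z \<nu> has_real_derivative F) (at \<tau> within {\<sigma>. 0 \<le> z 0 \<sigma>})
           \<longleftrightarrow> F = - jump (normal_flux U z \<nu> \<tau>) (z 1 \<tau>)"
proof -
  let ?S = "{\<sigma>. 0 \<le> z 0 \<sigma>}"
  let ?j = "\<lambda>\<sigma>. jump (normal_flux U z \<nu> \<sigma>) (z 1 \<sigma>)"
  let ?p = "dyn_momentum mt a U z \<nu>"
  note diff = momentum_diff[OF world_line \<nu> regular[OF \<nu>] no_concentration[OF _ \<nu>]
      conservation[OF _ _ _ \<nu>]]
  have up: "0 \<le> z 0 y" if "0 \<le> z 0 x" "x \<le> y" for x y
    using that strict_mono_less_eq[OF strict_mono_time[OF world_line], of x y] by linarith
  have deriv: "(?p has_real_derivative - ?j \<tau>) (at \<tau> within ?S)"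
  proof (rule has_real_derivative_of_integral)
    fix x y assume x: "x \<in> ?S" "x < y"
    show "set_integrable lborel {x..y} (\<lambda>\<sigma>. - ?j \<sigma>)"
      using set_integrable_mult_right[OF diff(1)[of x y], of "- 1"] x by simp
    show "?p y - ?p x = (LBINT s:{x..y}. - ?j s)"
      using diff[of x y] x by (simp add: set_integral_uminus)
  qed (use up \<tau> continuous_jump in \<open>auto intro: continuous_intros\<close>)
  \<comment> \<open>Uniqueness of the derivative needs \<tau> to be a limit point of
    \<open>?S\<close>. A right neighbourhood of \<tau> lies in \<open>?S\<close>, which settles this
    even when \<open>z 0 \<tau> = 0\<close>.\<close>
  have "{\<tau>..\<tau> + 1} \<subseteq> ?S"
    using up[OF \<tau>] by auto
  then have "at_right \<tau> \<le> at \<tau> within ?S"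
    using at_le[of "{\<tau>..\<tau> + 1}" ?S \<tau>] at_within_Icc_at_right[of \<tau> "\<tau> + 1"] by simp
  then have "at \<tau> within ?S \<noteq> bot"
    using trivial_limit_at_right_real[of \<tau>] by (metis le_bot)
  with deriv show ?thesis
    unfolding has_field_derivative_iff by (blast intro: tendsto_unique)
qed

end
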